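(* Let $n>3$ be odd and $m<n$ a positive integer with $\gcd(m,n)=\gcd(m-1,n)=1$. For every positive divisor $t$ of $n$, $\bigcup_{i=1}^{t}\langle H_i(t)\cup I\rangle=\langle L_n(m)\cup I\rangle$.
   Context: For $n>3$ odd and $m<n$ a positive integer with $\gcd(m,n)=\gcd(m-1,n)=1$, the loop $L_n(m)$ is the set $\{e,1,2,\dots,n\}$ with operation: $e\cdot i=i\cdot e=i$ for all $i$; $i\cdot i=e$ for all $i$; and for $i,j\in\{1,\dots,n\}$, $i\neq j$, $i\cdot j$ is the element $s\in\{1,\dots,n\}$ with $s\equiv mj-(m-1)i \pmod n$. The neutrosophic loop $\langle L_n(m)\cup I\rangle$ is the set $\{e,1,\dots,n,eI,1I,\dots,nI\}$ of $2(n+1)$ distinct symbols, with the product of $L_n(m)$ on $\{e,1,\dots,n\}$ and $x\cdot(yI)=(xI)\cdot y=(xI)\cdot(yI)=(x\cdot y)I$ for $x,y\in L_n(m)$. For a positive divisor $t$ of $n$, $k=n/t$ and $1\le i\le t$, $\langle H_i(t)\cup I\rangle=\{e,i,i+t,i+2t,\dots,i+(k-1)t,\ eI,iI,(i+t)I,(i+2t)I,\dots,(i+(k-1)t)I\}$. *)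

theory Defs
  imports "HOL-Algebra.Group" "HOL-Number_Theory.Cong"
begin

datatype loop_elem = E | El nat

text \<open>
  The record type of monoids only packages a carrier, a product and a unit; associativity
  is not assumed, and the loops below are in general not associative.  The product is only
  meaningful on arguments in the carrier.
\<close>

definition L_mult :: "nat \<Rightarrow> nat \<Rightarrow> loop_elem \<Rightarrow> loop_elem \<Rightarrow> loop_elem" where
  "L_mult n m x y =
    (case x of
       E \<Rightarrow> y
     | El i \<Rightarrow>
         (case y of
            E \<Rightarrow> x
          | El j \<Rightarrow>
              if i = j then E
              else El (THE s. s \<in> {1..n} \<and>
                        [int s = int m * int j - (int m - 1) * int i] (mod int n))))"

definition L_loop :: "nat \<Rightarrow> nat \<Rightarrow> loop_elem monoid" where
  "L_loop n m = \<lparr>carrier = insert E (El ` {1..n}), monoid.mult = L_mult n m, monoid.one = E\<rparr>"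

text \<open>\<open>Pure x\<close> is the symbol \<open>x\<close> itself, and \<open>Indet x\<close> is the symbol \<open>xI\<close>.\<close>

datatype 'a neutro = Pure 'a | Indet 'a

fun neutro_mult :: "('a \<Rightarrow> 'a \<Rightarrow> 'a) \<Rightarrow> 'a neutro \<Rightarrow> 'a neutro \<Rightarrow> 'a neutro" where
  "neutro_mult f (Pure x) (Pure y) = Pure (f x y)"
| "neutro_mult f (Pure x) (Indet y) = Indet (f x y)"
| "neutro_mult f (Indet x) (Pure y) = Indet (f x y)"
| "neutro_mult f (Indet x) (Indet y) = Indet (f x y)"

definition neutro_loop :: "'a monoid \<Rightarrow> 'a neutro monoid" where
  "neutro_loop L =
    \<lparr>carrier = Pure ` carrier L \<union> Indet ` carrier L,
     monoid.mult = neutro_mult (monoid.mult L),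
     monoid.one = Pure (monoid.one L)\<rparr>"

definition NH :: "nat \<Rightarrow> nat \<Rightarrow> nat \<Rightarrow> loop_elem neutro set" where
  "NH n t i =
    {Pure E} \<union> {Pure (El (i + r * t)) | r. r < n div t} \<union>
    {Indet E} \<union> {Indet (El (i + r * t)) | r. r < n div t}"

end

theory Submission imports Defs begin

text \<open>
  The heart of the matter is that the progressions \<open>i, i + t, \<dots>, i + (n div t - 1) * t\<close>
  for \<open>1 \<le> i \<le> t\<close> have union \<open>{1..n}\<close>: they are the residue classes modulo \<open>t\<close> within
  \<open>{1..n}\<close>.  This is division with remainder, applied to \<open>s - 1\<close> because representatives
  start at \<open>1\<close> rather than \<open>0\<close> (\<open>UN_progressions_eq_interval\<close>).  The two copies of these numbers,
  with and without \<open>I\<close>, are then treated alike, and \<open>e\<close> and \<open>eI\<close> lie in every member of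
  the union, which has at least one member since \<open>t\<close> is positive.
\<close>

lemma UN_progressions_eq_interval:
  fixes t k :: nat
  assumes "0 < t"
  shows "(\<Union>i\<in>{1..t}. {i + r * t | r. r < k}) = {1..k * t}"
proof (intro equalityI subsetI)
  fix s assume "s \<in> (\<Union>i\<in>{1..t}. {i + r * t | r. r < k})"
  then obtain i r where "i \<in> {1..t}" "r < k" and s: "s = i + r * t"
    by blast
  moreover have "Suc r * t \<le> k * t"
    using \<open>r < k\<close> by (intro mult_le_mono1) simp
  ultimately show "s \<in> {1..k * t}"
    by simp
next
  fix s assume s: "s \<in> {1..k * t}"
  define i where "i = Suc ((s - 1) mod t)"
  define r where "r = (s - 1) div t"
  have "s = i + r * t"
    using s mod_mult_div_eq[of "s - 1" t] by (simp add: i_def r_def mult.commute)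
  moreover have "i \<in> {1..t}"
    using assms by (simp add: i_def Suc_le_eq)
  moreover have "r < k"
    using s assms by (auto simp: r_def div_less_iff_less_mult)
  ultimately show "s \<in> (\<Union>i\<in>{1..t}. {i + r * t | r. r < k})"
    by blast
qed

lemma NH_eq_images:
  "NH n t i = Pure ` insert E (El ` {i + r * t | r. r < n div t}) \<union>
              Indet ` insert E (El ` {i + r * t | r. r < n div t})"
  by (auto simp: NH_def)

theorem corollary4p1p2:
  fixes n m t :: nat
  assumes "n > 3" and "odd n"
    and "0 < m" and "m < n"
    and "gcd m n = 1" and "gcd (m - 1) n = 1"
    and "0 < t" and "t dvd n"
  shows "(\<Union>i\<in>{1..t}. NH n t i) = carrier (neutro_loop (L_loop n m))"
proof -
  define P where "P i = {i + r * t | r. r < n div t}" for i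
  have cover: "(\<Union>i\<in>{1..t}. P i) = {1..n}"
    using UN_progressions_eq_interval[OF \<open>0 < t\<close>, of "n div t"] \<open>t dvd n\<close>
    by (simp add: P_def)
  have "{1..t} \<noteq> {}"
    using \<open>0 < t\<close> by simp
  then have "(\<Union>i\<in>{1..t}. NH n t i) =
      Pure ` insert E (El ` (\<Union>i\<in>{1..t}. P i)) \<union> Indet ` insert E (El ` (\<Union>i\<in>{1..t}. P i))"
    unfolding NH_eq_images P_def[symmetric] by blast
  also have "\<dots> = carrier (neutro_loop (L_loop n m))"
    unfolding cover by (simp add: neutro_loop_def L_loop_def)
  finally show ?thesis .
qed

end
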